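(* Let $\mu_1,\mu_2\in\mathbb{C}$ with $\mu_1+\mu_2\notin\mathbb{Z}$. (a) If $\mu_2\in\mathbb{Z}$ and $k_0\in\mathbb{Z}$, then $\eta_{k_0,\mu_2,0}$ generates $M_{\mu_1,\mu_2}^{\vee}$ as an $\mathfrak{sl}_3$-module. (b) If $\mu_1\in\mathbb{Z}$ and $l_0\in\mathbb{Z}$, then $\eta_{\mu_1,l_0,0}$ generates $M_{\mu_1,\mu_2}^{\vee}$ as an $\mathfrak{sl}_3$-module. In particular, $M_{\mu_1,\mu_2}^{\vee}$ is a cyclic $\mathfrak{sl}_3$-module for any $\mu_1,\mu_2$ (with $\mu_1+\mu_2\notin\mathbb{Z}$).
   Context: $\mathfrak{sl}_3$ is the complex Lie algebra with root vectors $e_1,e_2,e_{12}=[e_1,e_2]$ (roots $\alpha_1,\alpha_2,\alpha_1+\alpha_2$), $f_1,f_2,f_{12}=-[f_1,f_2]$ (the negative roots), and simple coroots $h_1,h_2$ spanning the Cartan subalgebra $\mathfrak{t}$; e.g. $e_1=E_{12}$, $e_2=E_{23}$, $e_{12}=E_{13}$, $f_1=E_{21}$, $f_2=E_{32}$, $f_{12}=E_{31}$. For $\mu_1,\mu_2\in\mathbb{C}$ the $\mathfrak{sl}_3$-module $M_{\mu_1,\mu_2}$ is the space of global sections of a rank one local system on $O=X_{w_\circ}\cap s_1X_{w_\circ}\cap s_2X_{w_\circ}\cong\mathbb{G}_m^2\times\mathbb{A}^1$ ($X_{w_\circ}$ the big cell of the flag variety of $\mathrm{SL}_3$), on which $\mathfrak{sl}_3$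 acts by infinitesimal left translations. Explicitly, write $\overline{k}=k-\mu_1$ and $\overline{l}=l-\mu_2$. Then $M_{\mu_1,\mu_2}$ has the $\mathbb{C}$-basis $u_{k,l,m}$, $k,l\in\mathbb{Z}$, $m\in\mathbb{Z}_{\ge0}$, with action $$e_1u_{k,l,m}=-\overline{k}\,u_{k-1,l,m},\qquad e_2u_{k,l,m}=-\overline{l}\,u_{k,l-1,m}+m\,u_{k+1,l,m-1},$$ $$h\,u_{k,l,m}=-\big((\overline{k}+m)\alpha_1(h)+(\overline{l}+m)\alpha_2(h)\big)u_{k,l,m}\quad(h\in\mathfrak{t}),$$ $$f_1u_{k,l,m}=(\overline{k}-\overline{l}+m)u_{k+1,l,m}-\overline{l}\,u_{k,l-1,m+1},\qquad f_2u_{k,l,m}=\overline{l}\,u_{k,l+1,m}+\overline{k}\,u_{k-1,l,m+1},$$ $$e_{12}u_{k,l,m}=-m\,u_{k,l,m-1},\qquad f_{12}u_{k,l,m}=(\overline{k}+\overline{l}+m)u_{k,l,m+1}+\overline{l}\,u_{k+1,l+1,m}$$ (terms with coefficient $m=0$ are zero). When $\mu_1+\mu_2\notin\mathbb{Z}$ define $$w_{k,l,m}=\sum_{n=0}^m\binom{m}{n}\frac{\overline{l}^{(n)}}{(\overline{k}+\overline{l})^{(n)}}\,u_{k+n,l+n,m-n},\qquad x^{(n)}=x(x+1)\cdots(x+n-1).$$ The $w_{k,l,m}$ form a basis of $M_{\mu_1,\mu_2}$ of simultaneous eigenvectors for $(h_1,h_2,f_{12}e_{12})$ with pairwise distinct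 simultaneous eigenvalues. Dual: if an $\mathfrak{sl}_3$-module $M$ is the direct sum of its finite dimensional simultaneous $(h_1,h_2,f_{12}e_{12})$-eigenspaces $M_\chi$, its dual is $M^\vee=\bigoplus_\chi\mathrm{Hom}_{\mathbb{C}}(M_\chi,\mathbb{C})$ with action $(X\eta)(v)=-\eta(\tau(X)v)$ for $X\in\mathfrak{sl}_3$, where $\tau$ is the involutive automorphism of $\mathfrak{sl}_3$ given by $h_1\mapsto-h_1$, $h_2\mapsto-h_2$, $f_1\leftrightarrow e_1$, $f_2\leftrightarrow e_2$, $-f_{12}\leftrightarrow e_{12}$ (functionals on $M_\chi$ are extended by zero to the other eigenspaces). The basis of $M_{\mu_1,\mu_2}^\vee$ dual to $w_{k,l,m}$ is denoted $\eta_{k,l,m}$, $k,l\in\mathbb{Z}$, $m\in\mathbb{Z}_{\ge0}$. *)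

theory Defs
  imports
    "HOL-Analysis.Analysis"
    "HOL-Library.Poly_Mapping"
    "HOL-Library.Function_Algebras"
begin

section \<open>The Lie algebra\<close>

definition sl3 :: "(complex^3^3) set" where
  "sl3 = {X. trace X = 0}"

definition bracket :: "complex^3^3 \<Rightarrow> complex^3^3 \<Rightarrow> complex^3^3" where
  "bracket X Y = X ** Y - Y ** X"

definition matrix_scale :: "complex \<Rightarrow> complex^3^3 \<Rightarrow> complex^3^3" where
  "matrix_scale c X = (\<chi> i j. c * X $ i $ j)"

definition matrix_unit :: "3 \<Rightarrow> 3 \<Rightarrow> complex^3^3" where
  "matrix_unit a b = (\<chi> i j. if i = a \<and> j = b then 1 else 0)"

definition sl3_e1 :: "complex^3^3" where "sl3_e1 = matrix_unit 1 2"
definition sl3_e2 :: "complex^3^3" where "sl3_e2 = matrix_unit 2 3"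
definition sl3_e12 :: "complex^3^3" where "sl3_e12 = matrix_unit 1 3"
definition sl3_f1 :: "complex^3^3" where "sl3_f1 = matrix_unit 2 1"
definition sl3_f2 :: "complex^3^3" where "sl3_f2 = matrix_unit 3 2"
definition sl3_f12 :: "complex^3^3" where "sl3_f12 = matrix_unit 3 1"
definition sl3_h1 :: "complex^3^3" where "sl3_h1 = matrix_unit 1 1 - matrix_unit 2 2"
definition sl3_h2 :: "complex^3^3" where "sl3_h2 = matrix_unit 2 2 - matrix_unit 3 3"

lemmas sl3_generator_defs =
  sl3_e1_def sl3_e2_def sl3_e12_def sl3_f1_def sl3_f2_def sl3_f12_def sl3_h1_def sl3_h2_def

text \<open>Equivalently \<open>tau X = - D X\<^sup>T D\<close> with \<open>D = diag(1, -1, 1)\<close>.\<close>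

definition tau :: "complex^3^3 \<Rightarrow> complex^3^3" where
  "tau X = vector [vector [- (X $ 1 $ 1),    X $ 2 $ 1,  - (X $ 3 $ 1)],
                   vector [   X $ 1 $ 2,  - (X $ 2 $ 2),    X $ 3 $ 2],
                   vector [- (X $ 1 $ 3),    X $ 2 $ 3,  - (X $ 3 $ 3)]]"

lemma tau_generators:
  "tau sl3_h1 = - sl3_h1" "tau sl3_h2 = - sl3_h2"
  "tau sl3_f1 = sl3_e1" "tau sl3_e1 = sl3_f1"
  "tau sl3_f2 = sl3_e2" "tau sl3_e2 = sl3_f2"
  "tau (- sl3_f12) = sl3_e12" "tau sl3_e12 = - sl3_f12"
  by (simp_all add: tau_def sl3_generator_defs matrix_unit_def vec_eq_iff forall_3 vector_3)

lemma tau_automorphism: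
  "tau (X + Y) = tau X + tau Y"
  "tau (matrix_scale c X) = matrix_scale c (tau X)"
  "tau (bracket X Y) = bracket (tau X) (tau Y)"
  "tau (tau X) = X"
  "tau X \<in> sl3 \<longleftrightarrow> X \<in> sl3"
proof -
  show "tau (bracket X Y) = bracket (tau X) (tau Y)"
    by (simp add: tau_def bracket_def matrix_matrix_mult_def vec_eq_iff forall_3 vector_3 sum_3)
  have "trace (tau X) = - trace X"
    by (simp add: tau_def trace_def sum_3 vector_3)
  then show "tau X \<in> sl3 \<longleftrightarrow> X \<in> sl3"
    by (simp add: sl3_def)
qed (simp_all add: tau_def matrix_scale_def vec_eq_iff forall_3 vector_3)


section \<open>Modules over the Lie algebra\<close>

locale sl3_module = vector_space scl
  for scl :: "complex \<Rightarrow> 'v::ab_group_add \<Rightarrow> 'v" +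
  fixes V :: "'v set" and act :: "complex^3^3 \<Rightarrow> 'v \<Rightarrow> 'v"
  assumes subspace_carrier: "subspace V"
    and act_closed: "X \<in> sl3 \<Longrightarrow> v \<in> V \<Longrightarrow> act X v \<in> V"
    and act_add: "X \<in> sl3 \<Longrightarrow> v \<in> V \<Longrightarrow> w \<in> V \<Longrightarrow> act X (v + w) = act X v + act X w"
    and act_scale: "X \<in> sl3 \<Longrightarrow> v \<in> V \<Longrightarrow> act X (scl c v) = scl c (act X v)"
    and act_add_left:
      "X \<in> sl3 \<Longrightarrow> Y \<in> sl3 \<Longrightarrow> v \<in> V \<Longrightarrow> act (X + Y) v = act X v + act Y v"
    and act_scale_left:
      "X \<in> sl3 \<Longrightarrow> v \<in> V \<Longrightarrow> act (matrix_scale c X) v = scl c (act X v)"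
    and act_bracket:
      "X \<in> sl3 \<Longrightarrow> Y \<in> sl3 \<Longrightarrow> v \<in> V \<Longrightarrow>
        act (bracket X Y) v = act X (act Y v) - act Y (act X v)"

definition sl3_submodule ::
  "(complex \<Rightarrow> 'v::ab_group_add \<Rightarrow> 'v) \<Rightarrow> 'v set \<Rightarrow> (complex^3^3 \<Rightarrow> 'v \<Rightarrow> 'v) \<Rightarrow> 'v set \<Rightarrow> bool"
where
  "sl3_submodule scl V act N \<longleftrightarrow>
     N \<subseteq> V \<and> module.subspace scl N \<and> (\<forall>X\<in>sl3. \<forall>v\<in>N. act X v \<in> N)"

definition generates_sl3_module ::
  "(complex \<Rightarrow> 'v::ab_group_add \<Rightarrow> 'v) \<Rightarrow> 'v set \<Rightarrow> (complex^3^3 \<Rightarrow> 'v \<Rightarrow> 'v) \<Rightarrow> 'v \<Rightarrow> bool"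
where
  "generates_sl3_module scl V act v \<longleftrightarrow>
     sl3_module scl V act \<and> v \<in> V \<and> \<Inter>{N. sl3_submodule scl V act N \<and> v \<in> N} = V"

definition cyclic_sl3_module ::
  "(complex \<Rightarrow> 'v::ab_group_add \<Rightarrow> 'v) \<Rightarrow> 'v set \<Rightarrow> (complex^3^3 \<Rightarrow> 'v \<Rightarrow> 'v) \<Rightarrow> bool"
where
  "cyclic_sl3_module scl V act \<longleftrightarrow>
     sl3_module scl V act \<and> (\<exists>v\<in>V. generates_sl3_module scl V act v)"


section \<open>The dual module\<close>

text \<open>The dual is formed of a module whose carrier is a whole type. A triple \<open>(a, b, c)\<close> is the
  simultaneous eigenvalue of \<open>(h\<^sub>1, h\<^sub>2, f\<^sub>1\<^sub>2 e\<^sub>1\<^sub>2)\<close>, the last being a composite operator, not a Lie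
  algebra element.\<close>

fun sl3_eigenspace ::
  "(complex \<Rightarrow> 'v::ab_group_add \<Rightarrow> 'v) \<Rightarrow> (complex^3^3 \<Rightarrow> 'v \<Rightarrow> 'v) \<Rightarrow>
     complex \<times> complex \<times> complex \<Rightarrow> 'v set"
where
  "sl3_eigenspace scl act (a, b, c) =
     {v. act sl3_h1 v = scl a v \<and> act sl3_h2 v = scl b v \<and>
         act sl3_f12 (act sl3_e12 v) = scl c v}"

definition functional_scale :: "complex \<Rightarrow> ('v \<Rightarrow> complex) \<Rightarrow> 'v \<Rightarrow> complex" where
  "functional_scale c \<eta> = (\<lambda>v. c * \<eta> v)"

text \<open>Functionals on one eigenspace, extended by zero: linear functionals on the whole module that
  vanish on all other eigenspaces. The span below is the direct sum of these spaces when the module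
  is the direct sum of its eigenspaces, the only case in which the dual is used.\<close>

definition sl3_dual_component ::
  "(complex \<Rightarrow> 'v::ab_group_add \<Rightarrow> 'v) \<Rightarrow> (complex^3^3 \<Rightarrow> 'v \<Rightarrow> 'v) \<Rightarrow>
     complex \<times> complex \<times> complex \<Rightarrow> ('v \<Rightarrow> complex) set"
where
  "sl3_dual_component scl act \<theta> =
     {\<eta>. Vector_Spaces.linear scl (*) \<eta> \<and>
          (\<forall>\<theta>'. \<theta>' \<noteq> \<theta> \<longrightarrow> (\<forall>v\<in>sl3_eigenspace scl act \<theta>'. \<eta> v = 0))}"

definition sl3_dual ::
  "(complex \<Rightarrow> 'v::ab_group_add \<Rightarrow> 'v) \<Rightarrow> (complex^3^3 \<Rightarrow> 'v \<Rightarrow> 'v) \<Rightarrow> ('v \<Rightarrow> complex) set"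
where
  "sl3_dual scl act = module.span functional_scale (\<Union>\<theta>. sl3_dual_component scl act \<theta>)"

definition dual_act ::
  "(complex^3^3 \<Rightarrow> 'v \<Rightarrow> 'v) \<Rightarrow> complex^3^3 \<Rightarrow> ('v \<Rightarrow> complex) \<Rightarrow> 'v \<Rightarrow> complex"
where
  "dual_act act X \<eta> = (\<lambda>v. - \<eta> (act (tau X) v))"

lemma vector_space_functional_scale: "vector_space functional_scale"
  by unfold_locales (auto simp: functional_scale_def algebra_simps)


section \<open>The module with parameters \<open>\<mu>\<^sub>1\<close> and \<open>\<mu>\<^sub>2\<close>\<close>

text \<open>The underlying space is the space of finitely supported functions on the index set of the
  basis \<open>u\<close>.\<close>

type_synonym loc = "(int \<times> int \<times> nat) \<Rightarrow>\<^sub>0 complex"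

definition loc_scale :: "complex \<Rightarrow> loc \<Rightarrow> loc" where
  "loc_scale c v = Poly_Mapping.map ((*) c) v"

definition u_vec :: "int \<Rightarrow> int \<Rightarrow> nat \<Rightarrow> loc" where
  "u_vec k l m = Poly_Mapping.single (k, l, m) 1"

text \<open>The entry of \<open>X\<close> at a root position is the coefficient of \<open>X\<close> at the corresponding root
  vector; the diagonal part \<open>h\<close> of \<open>X\<close> enters via \<open>\<alpha>\<^sub>1(h) = X\<^sub>1\<^sub>1 - X\<^sub>2\<^sub>2\<close> and
  \<open>\<alpha>\<^sub>2(h) = X\<^sub>2\<^sub>2 - X\<^sub>3\<^sub>3\<close>.\<close>

definition loc_act_u :: "complex \<Rightarrow> complex \<Rightarrow> complex^3^3 \<Rightarrow> int \<Rightarrow> int \<Rightarrow> nat \<Rightarrow> loc" where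
  "loc_act_u \<mu>1 \<mu>2 X k l m =
    (let kb = of_int k - \<mu>1; lb = of_int l - \<mu>2; mm = (of_nat m :: complex) in
       loc_scale (X $ 1 $ 2) (loc_scale (- kb) (u_vec (k - 1) l m))
     + loc_scale (X $ 2 $ 3) (loc_scale (- lb) (u_vec k (l - 1) m) +
                              loc_scale mm (u_vec (k + 1) l (m - 1)))
     + loc_scale (X $ 1 $ 3) (loc_scale (- mm) (u_vec k l (m - 1)))
     + loc_scale (X $ 2 $ 1) (loc_scale (kb - lb + mm) (u_vec (k + 1) l m) -
                              loc_scale lb (u_vec k (l - 1) (m + 1)))
     + loc_scale (X $ 3 $ 2) (loc_scale lb (u_vec k (l + 1) m) +
                              loc_scale kb (u_vec (k - 1) l (m + 1)))
     + loc_scale (X $ 3 $ 1) (loc_scale (kb + lb + mm) (u_vec k l (m + 1)) +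
                              loc_scale lb (u_vec (k + 1) (l + 1) m))
     + loc_scale (- ((kb + mm) * (X $ 1 $ 1 - X $ 2 $ 2) + (lb + mm) * (X $ 2 $ 2 - X $ 3 $ 3)))
         (u_vec k l m))"

definition loc_act :: "complex \<Rightarrow> complex \<Rightarrow> complex^3^3 \<Rightarrow> loc \<Rightarrow> loc" where
  "loc_act \<mu>1 \<mu>2 X v =
     (\<Sum>(k, l, m)\<in>Poly_Mapping.keys v.
        loc_scale (Poly_Mapping.lookup v (k, l, m)) (loc_act_u \<mu>1 \<mu>2 X k l m))"

definition w_vec :: "complex \<Rightarrow> complex \<Rightarrow> int \<Rightarrow> int \<Rightarrow> nat \<Rightarrow> loc" where
  "w_vec \<mu>1 \<mu>2 k l m =
    (let kb = of_int k - \<mu>1; lb = of_int l - \<mu>2 in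
     \<Sum>n=0..m. loc_scale (of_nat (m choose n) * (pochhammer lb n / pochhammer (kb + lb) n))
                 (u_vec (k + int n) (l + int n) (m - n)))"

definition loc_dual :: "complex \<Rightarrow> complex \<Rightarrow> (loc \<Rightarrow> complex) set" where
  "loc_dual \<mu>1 \<mu>2 = sl3_dual loc_scale (loc_act \<mu>1 \<mu>2)"

definition loc_dual_act ::
  "complex \<Rightarrow> complex \<Rightarrow> complex^3^3 \<Rightarrow> (loc \<Rightarrow> complex) \<Rightarrow> loc \<Rightarrow> complex" where
  "loc_dual_act \<mu>1 \<mu>2 = dual_act (loc_act \<mu>1 \<mu>2)"

text \<open>The coordinate functional of \<open>w\<^sub>k\<^sub>,\<^sub>l\<^sub>,\<^sub>m\<close> with respect to the basis \<open>w\<close>; meaningful when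
  \<open>\<mu>\<^sub>1 + \<mu>\<^sub>2\<close> is not an integer, since the \<open>w\<close> then form a basis.\<close>

definition eta :: "complex \<Rightarrow> complex \<Rightarrow> int \<Rightarrow> int \<Rightarrow> nat \<Rightarrow> loc \<Rightarrow> complex" where
  "eta \<mu>1 \<mu>2 k l m =
     (\<lambda>v. module.representation loc_scale (range (\<lambda>(k, l, m). w_vec \<mu>1 \<mu>2 k l m)) v
            (w_vec \<mu>1 \<mu>2 k l m))"

lemma lookup_loc_scale [simp]:
  "Poly_Mapping.lookup (loc_scale c v) i = c * Poly_Mapping.lookup v i"
  unfolding loc_scale_def by (simp add: Poly_Mapping.map.rep_eq when_def)

lemma vector_space_loc_scale: "vector_space loc_scale"
  by unfold_locales (auto intro!: poly_mapping_eqI simp: lookup_add algebra_simps)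

end

theory Submission
  imports Defs
begin

text \<open>Every root vector maps \<open>w\<^sub>k\<^sub>,\<^sub>l\<^sub>,\<^sub>m\<close> to a combination of at most two basis vectors \<open>w\<close>; the
  formulas follow by induction on \<open>m\<close> from \<open>f\<^sub>1\<^sub>2 w\<^sub>k\<^sub>,\<^sub>l\<^sub>,\<^sub>m = (a + b + m) w\<^sub>k\<^sub>,\<^sub>l\<^sub>,\<^sub>m\<^sub>+\<^sub>1\<close> and the commutators
  with \<open>f\<^sub>1\<^sub>2\<close>, where \<open>a = k - \<mu>\<^sub>1\<close> and \<open>b = l - \<mu>\<^sub>2\<close>. Transposing them, a submodule of the dual
  containing \<open>\<eta>\<^sub>k\<^sub>,\<^sub>l\<^sub>,\<^sub>0\<close> contains \<open>\<eta>\<^sub>k\<^sub>,\<^sub>l\<^sub>,\<^sub>m\<close> for all \<open>m\<close> (apply \<open>f\<^sub>1\<^sub>2\<close>),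
  \<open>\<eta>\<^sub>k\<^sub>-\<^sub>1\<^sub>,\<^sub>l\<^sub>,\<^sub>0\<close> unless \<open>a \<in> {1, 2}\<close> (apply \<open>e\<^sub>1\<close>) and \<open>\<eta>\<^sub>k\<^sub>+\<^sub>1\<^sub>,\<^sub>l\<^sub>,\<^sub>0\<close> unless \<open>a = -1\<close> (apply \<open>f\<^sub>1\<close> and
  correct by a multiple of \<open>f\<^sub>1\<^sub>2 e\<^sub>2\<close>), and symmetrically in \<open>l\<close>. Starting from \<open>a = 0\<close> or \<open>a\<close> not an
  integer, and likewise for \<open>b\<close>, no step is obstructed.\<close>

section \<open>The action on the module\<close>

interpretation loc: vector_space loc_scale
  by (rule vector_space_loc_scale)

interpretation functional: vector_space functional_scale
  by (rule vector_space_functional_scale)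

text \<open>The sum in \<open>loc_act\<close> runs over the keys of its own argument. A common
  finite index set lets the sums for several vectors be compared term by term.\<close>

lemma loc_act_superset:
  assumes "finite A" "Poly_Mapping.keys v \<subseteq> A"
  shows "loc_act \<mu>1 \<mu>2 X v =
    (\<Sum>(k, l, m)\<in>A. loc_scale (Poly_Mapping.lookup v (k, l, m)) (loc_act_u \<mu>1 \<mu>2 X k l m))"
  unfolding loc_act_def using assms
  by (intro sum.mono_neutral_left) (auto simp: in_keys_iff)

lemma loc_act_add: "loc_act \<mu>1 \<mu>2 X (v + w) = loc_act \<mu>1 \<mu>2 X v + loc_act \<mu>1 \<mu>2 X w"
proof -
  let ?A = "Poly_Mapping.keys v \<union> Poly_Mapping.keys w"
  have "Poly_Mapping.keys (v + w) \<subseteq> ?A"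
    by (rule Poly_Mapping.keys_add)
  then show ?thesis
    by (simp add: loc_act_superset[of ?A] lookup_add loc.scale_left_distrib sum.distrib
        case_prod_unfold)
qed

lemma loc_act_scale: "loc_act \<mu>1 \<mu>2 X (loc_scale c v) = loc_scale c (loc_act \<mu>1 \<mu>2 X v)"
proof -
  have "Poly_Mapping.keys (loc_scale c v) \<subseteq> Poly_Mapping.keys v"
    by (auto simp: in_keys_iff)
  then show ?thesis
    by (simp add: loc_act_superset[of "Poly_Mapping.keys v"] loc.scale_sum_right
        case_prod_unfold)
qed

lemma linear_loc_act: "Vector_Spaces.linear loc_scale loc_scale (loc_act \<mu>1 \<mu>2 X)"
  by (intro Vector_Spaces.linear_iff[THEN iffD2] conjI allI vector_space_loc_scale
      loc_act_add loc_act_scale)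

interpretation loc_act: Vector_Spaces.linear loc_scale loc_scale "loc_act \<mu>1 \<mu>2 X" for \<mu>1 \<mu>2 X
  by (rule linear_loc_act)

lemma loc_act_u_vec [simp]: "loc_act \<mu>1 \<mu>2 X (u_vec k l m) = loc_act_u \<mu>1 \<mu>2 X k l m"
  by (simp add: loc_act_def u_vec_def)

lemma loc_eq_sum_u:
  "v = (\<Sum>(k, l, m)\<in>Poly_Mapping.keys v. loc_scale (Poly_Mapping.lookup v (k, l, m)) (u_vec k l m))"
  by (rule poly_mapping_eqI)
    (auto simp: lookup_sum u_vec_def lookup_single when_def case_prod_unfold in_keys_iff
      if_distrib cong: if_cong)

lemma span_u: "loc.span (range (\<lambda>(k, l, m). u_vec k l m)) = UNIV"
proof -
  have "v \<in> loc.span (range (\<lambda>(k, l, m). u_vec k l m))" for v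
    by (subst loc_eq_sum_u, unfold case_prod_unfold)
      (intro loc.span_sum loc.span_scale loc.span_base rangeI)
  then show ?thesis
    by blast
qed

lemma linear_eqI_u:
  assumes "Vector_Spaces.linear loc_scale scl f" "Vector_Spaces.linear loc_scale scl g"
    and "\<And>k l m. f (u_vec k l m) = g (u_vec k l m)"
  shows "f v = g v"
proof -
  interpret vector_space_pair loc_scale scl
    using assms(1) by (simp add: Vector_Spaces.linear_iff vector_space_pair_def)
  show ?thesis
    by (rule linear_eq_on[OF assms(1,2), of v "range (\<lambda>(k, l, m). u_vec k l m)"])
      (auto simp: span_u assms(3))
qed

lemma linear_locI:
  assumes "\<And>v w. f (v + w) = f v + f w" "\<And>c v. f (loc_scale c v) = loc_scale c (f v)"
  shows "Vector_Spaces.linear loc_scale loc_scale f"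
  using assms by (simp add: Vector_Spaces.linear_iff vector_space_loc_scale)

lemma loc_act_bracket:
  "loc_act \<mu>1 \<mu>2 (bracket X Y) v =
    loc_act \<mu>1 \<mu>2 X (loc_act \<mu>1 \<mu>2 Y v) - loc_act \<mu>1 \<mu>2 Y (loc_act \<mu>1 \<mu>2 X v)"
proof (rule linear_eqI_u[where scl = loc_scale, OF linear_loc_act])
  show "Vector_Spaces.linear loc_scale loc_scale
    (\<lambda>v. loc_act \<mu>1 \<mu>2 X (loc_act \<mu>1 \<mu>2 Y v) - loc_act \<mu>1 \<mu>2 Y (loc_act \<mu>1 \<mu>2 X v))"
    by (rule linear_locI) (simp_all add: loc_act_add loc_act_scale loc.scale_right_diff_distrib)
next
  fix k l m
  let ?P = "\<lambda>m. loc_act \<mu>1 \<mu>2 (bracket X Y) (u_vec k l m) =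
    loc_act \<mu>1 \<mu>2 X (loc_act \<mu>1 \<mu>2 Y (u_vec k l m)) - loc_act \<mu>1 \<mu>2 Y (loc_act \<mu>1 \<mu>2 X (u_vec k l m))"
  note linear_simps = loc_act_u_def Let_def loc_act_add loc_act_scale loc_act.diff loc_act.neg lookup_add
    lookup_minus lookup_uminus
  note matrix_simps = bracket_def matrix_matrix_mult_def sum_3
  \<comment> \<open>Two operators lower the third index by at most 2, with truncated subtraction.
    Splitting off 0 and 1 makes every remaining difference genuine; in the two small cases the
    coefficients of the truncated terms vanish.\<close>
  have "?P 0"
    by (rule poly_mapping_eqI, simp add: linear_simps, simp add: matrix_simps, algebra)
  moreover have "?P (Suc 0)"
    by (rule poly_mapping_eqI, simp add: linear_simps, simp add: matrix_simps, algebra)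
  moreover have "?P (Suc (Suc n))" for n
    by (rule poly_mapping_eqI, simp add: linear_simps, simp add: matrix_simps, algebra)
  ultimately show "?P m"
    by (metis not0_implies_Suc)
qed

lemma loc_act_add_left: "loc_act \<mu>1 \<mu>2 (X + Y) v = loc_act \<mu>1 \<mu>2 X v + loc_act \<mu>1 \<mu>2 Y v"
proof (rule linear_eqI_u[where scl = loc_scale, OF linear_loc_act linear_locI])
  show "loc_act \<mu>1 \<mu>2 (X + Y) (u_vec k l m) =
      loc_act \<mu>1 \<mu>2 X (u_vec k l m) + loc_act \<mu>1 \<mu>2 Y (u_vec k l m)" for k l m
    by (rule poly_mapping_eqI) (simp add: loc_act_u_def Let_def lookup_add lookup_minus algebra_simps)
qed (simp_all add: loc_act_add loc_act_scale loc.scale_right_distrib)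

lemma loc_act_scale_left: "loc_act \<mu>1 \<mu>2 (matrix_scale c X) v = loc_scale c (loc_act \<mu>1 \<mu>2 X v)"
proof (rule linear_eqI_u[where scl = loc_scale, OF linear_loc_act linear_locI])
  show "loc_act \<mu>1 \<mu>2 (matrix_scale c X) (u_vec k l m) =
      loc_scale c (loc_act \<mu>1 \<mu>2 X (u_vec k l m))" for k l m
    by (rule poly_mapping_eqI)
      (simp add: loc_act_u_def Let_def lookup_add lookup_minus matrix_scale_def algebra_simps)
qed (simp_all add: loc_act_add loc_act_scale loc.scale_right_distrib mult.commute)

lemmas matrix_entries = sl3_generator_defs matrix_unit_def matrix_scale_def

text \<open>The vanishing trace makes the diagonal part of \<open>X\<close> equal to
  \<open>X $ 1 $ 1\<close> times \<open>sl3_h1\<close> minus \<open>X $ 3 $ 3\<close> times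
  \<open>sl3_h2\<close>. Closure of the dual under all of \<open>sl3\<close> thereby reduces to
  eight operators.\<close>

lemma loc_act_generators_decomposition:
  assumes "X \<in> sl3"
  shows "loc_act \<mu>1 \<mu>2 X v =
      loc_scale (X $ 1 $ 2) (loc_act \<mu>1 \<mu>2 sl3_e1 v) + loc_scale (X $ 2 $ 3) (loc_act \<mu>1 \<mu>2 sl3_e2 v)
    + loc_scale (X $ 1 $ 3) (loc_act \<mu>1 \<mu>2 sl3_e12 v) + loc_scale (X $ 2 $ 1) (loc_act \<mu>1 \<mu>2 sl3_f1 v)
    + loc_scale (X $ 3 $ 2) (loc_act \<mu>1 \<mu>2 sl3_f2 v) + loc_scale (X $ 3 $ 1) (loc_act \<mu>1 \<mu>2 sl3_f12 v)
    + loc_scale (X $ 1 $ 1) (loc_act \<mu>1 \<mu>2 sl3_h1 v)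
    + loc_scale (- (X $ 3 $ 3)) (loc_act \<mu>1 \<mu>2 sl3_h2 v)"
proof -
  have tr: "X $ 2 $ 2 = - (X $ 1 $ 1) - X $ 3 $ 3"
    using assms by (simp add: sl3_def trace_def sum_3 algebra_simps eq_neg_iff_add_eq_0)
  have "X = matrix_scale (X $ 1 $ 2) sl3_e1 + matrix_scale (X $ 2 $ 3) sl3_e2
    + matrix_scale (X $ 1 $ 3) sl3_e12 + matrix_scale (X $ 2 $ 1) sl3_f1
    + matrix_scale (X $ 3 $ 2) sl3_f2 + matrix_scale (X $ 3 $ 1) sl3_f12
    + matrix_scale (X $ 1 $ 1) sl3_h1 + matrix_scale (- (X $ 3 $ 3)) sl3_h2"
    by (simp add: vec_eq_iff forall_3 matrix_entries tr)
  then show ?thesis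
    by (metis loc_act_add_left loc_act_scale_left)
qed

lemma generators_in_sl3:
  "sl3_e1 \<in> sl3" "sl3_e2 \<in> sl3" "sl3_f1 \<in> sl3" "sl3_f2 \<in> sl3" "sl3_f12 \<in> sl3"
  by (simp_all add: sl3_def trace_def sum_3 matrix_entries)

lemma loc_act_zero_left: "loc_act \<mu>1 \<mu>2 0 v = 0"
  using loc_act_add_left[of \<mu>1 \<mu>2 0 0 v] by simp

lemma loc_act_uminus_left: "loc_act \<mu>1 \<mu>2 (- X) v = - loc_act \<mu>1 \<mu>2 X v"
  using loc_act_add_left[of \<mu>1 \<mu>2 X "- X" v]
  by (simp add: loc_act_zero_left eq_neg_iff_add_eq_0 add.commute)

lemma bracket_generators:
  "bracket sl3_f12 sl3_e1 = sl3_f2" "bracket sl3_e2 sl3_f12 = sl3_f1"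
  "bracket sl3_f12 sl3_f1 = 0" "bracket sl3_f12 sl3_f2 = 0"
  "bracket sl3_e12 sl3_f12 = sl3_h1 + sl3_h2"
  by (simp_all add: vec_eq_iff forall_3 bracket_def matrix_matrix_mult_def sum_3 matrix_entries)

text \<open>Each identity moves \<open>sl3_f12\<close> to the left. Since \<open>sl3_f12\<close>
  raises m on the vectors \<open>w\<close>, this supplies the induction steps for the other
  generators.\<close>

lemma loc_act_commutators:
  "loc_act \<mu>1 \<mu>2 sl3_e1 (loc_act \<mu>1 \<mu>2 sl3_f12 v) =
     loc_act \<mu>1 \<mu>2 sl3_f12 (loc_act \<mu>1 \<mu>2 sl3_e1 v) - loc_act \<mu>1 \<mu>2 sl3_f2 v"
  "loc_act \<mu>1 \<mu>2 sl3_e2 (loc_act \<mu>1 \<mu>2 sl3_f12 v) =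
     loc_act \<mu>1 \<mu>2 sl3_f12 (loc_act \<mu>1 \<mu>2 sl3_e2 v) + loc_act \<mu>1 \<mu>2 sl3_f1 v"
  "loc_act \<mu>1 \<mu>2 sl3_f1 (loc_act \<mu>1 \<mu>2 sl3_f12 v) =
     loc_act \<mu>1 \<mu>2 sl3_f12 (loc_act \<mu>1 \<mu>2 sl3_f1 v)"
  "loc_act \<mu>1 \<mu>2 sl3_f2 (loc_act \<mu>1 \<mu>2 sl3_f12 v) =
     loc_act \<mu>1 \<mu>2 sl3_f12 (loc_act \<mu>1 \<mu>2 sl3_f2 v)"
  "loc_act \<mu>1 \<mu>2 sl3_e12 (loc_act \<mu>1 \<mu>2 sl3_f12 v) =
     loc_act \<mu>1 \<mu>2 sl3_f12 (loc_act \<mu>1 \<mu>2 sl3_e12 v)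
     + (loc_act \<mu>1 \<mu>2 sl3_h1 v + loc_act \<mu>1 \<mu>2 sl3_h2 v)"
  using loc_act_bracket[of \<mu>1 \<mu>2 sl3_f12 sl3_e1 v] loc_act_bracket[of \<mu>1 \<mu>2 sl3_e2 sl3_f12 v]
    loc_act_bracket[of \<mu>1 \<mu>2 sl3_f12 sl3_f1 v] loc_act_bracket[of \<mu>1 \<mu>2 sl3_f12 sl3_f2 v]
    loc_act_bracket[of \<mu>1 \<mu>2 sl3_e12 sl3_f12 v]
  by (simp_all add: bracket_generators loc_act_zero_left loc_act_add_left algebra_simps)

section \<open>The action on the basis of eigenvectors\<close>

locale nonintegral_sum =
  fixes \<mu>1 \<mu>2 :: complex
  assumes nonintegral: "\<mu>1 + \<mu>2 \<notin> \<int>"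
begin

abbreviation "act \<equiv> loc_act \<mu>1 \<mu>2"
abbreviation "u \<equiv> u_vec"
abbreviation "w \<equiv> w_vec \<mu>1 \<mu>2"

definition kb :: "int \<Rightarrow> complex" where "kb k = of_int k - \<mu>1"
definition lb :: "int \<Rightarrow> complex" where "lb l = of_int l - \<mu>2"

text \<open>With respect to the Lie algebra spanned by \<open>e\<^sub>1\<^sub>2\<close>, \<open>f\<^sub>1\<^sub>2\<close> and their bracket, the module is a direct
  sum of Verma modules, one for each \<open>(k, l)\<close>, with basis \<open>w\<^sub>k\<^sub>,\<^sub>l\<^sub>,\<^sub>m\<close> in \<open>m\<close>. The other root vectors form
  two doublets, and \<open>p\<close>, \<open>q\<close> are the Clebsch-Gordan coefficients for their action.\<close>

definition p :: "int \<Rightarrow> int \<Rightarrow> complex" where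
  "p k l = kb k * (kb k - 1) / ((kb k + lb l) * (kb k + lb l - 1))"
definition q :: "int \<Rightarrow> int \<Rightarrow> complex" where
  "q k l = lb l * (lb l - 1) / ((kb k + lb l) * (kb k + lb l - 1))"

lemma kb_shift [simp]: "kb (k + 1) = kb k + 1" "kb (1 + k) = kb k + 1" "kb (k - 1) = kb k - 1"
  "kb (k + int n) = kb k + of_nat n"
  by (simp_all add: kb_def)

lemma lb_shift [simp]: "lb (l + 1) = lb l + 1" "lb (1 + l) = lb l + 1" "lb (l - 1) = lb l - 1"
  "lb (l + int n) = lb l + of_nat n"
  by (simp_all add: lb_def)

text \<open>The sum \<open>kb k + lb l\<close> differs from \<open>- (\<mu>1 + \<mu>2)\<close> by an
  integer. Every denominator below, and every scalar by which \<open>sl3_f12\<close> raises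
  \<open>w\<close>, is nonzero for this reason.\<close>

lemma sum_nonzero:
  assumes "c \<in> \<int>"
  shows "kb k + lb l + c \<noteq> 0"
proof
  assume "kb k + lb l + c = 0"
  then have "\<mu>1 + \<mu>2 = of_int k + of_int l + c"
    by (simp add: kb_def lb_def algebra_simps)
  with assms nonintegral show False
    by (metis Ints_add Ints_of_int)
qed

lemma sum_nonzero_simps [simp]:
  "kb k + lb l \<noteq> 0" "kb k + lb l - 1 \<noteq> 0" "kb k + lb l + of_nat n \<noteq> 0"
  "kb k + lb l \<noteq> 1"
  using sum_nonzero[of 0] sum_nonzero[of "-1"] sum_nonzero[of "of_nat n"] by simp_all

lemma pochhammer_sum_nonzero [simp]: "pochhammer (kb k + lb l) n \<noteq> 0"
  by (metis Ints_of_nat add_neg_numeral_special(7) eq_neg_iff_add_eq_0 pochhammer_eq_0_iff sum_nonzero)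

lemma act_u:
  "act sl3_e1 (u k l m) = loc_scale (- kb k) (u (k - 1) l m)"
  "act sl3_e2 (u k l m) = loc_scale (- lb l) (u k (l - 1) m) + loc_scale (of_nat m) (u (k + 1) l (m - 1))"
  "act sl3_e12 (u k l m) = loc_scale (- of_nat m) (u k l (m - 1))"
  "act sl3_f1 (u k l m) = loc_scale (kb k - lb l + of_nat m) (u (k + 1) l m)
     - loc_scale (lb l) (u k (l - 1) (m + 1))"
  "act sl3_f2 (u k l m) = loc_scale (lb l) (u k (l + 1) m) + loc_scale (kb k) (u (k - 1) l (m + 1))"
  "act sl3_f12 (u k l m) = loc_scale (kb k + lb l + of_nat m) (u k l (m + 1))
     + loc_scale (lb l) (u (k + 1) (l + 1) m)"
  "act sl3_h1 (u k l m) = loc_scale (- (2 * (kb k + of_nat m) - (lb l + of_nat m))) (u k l m)"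
  "act sl3_h2 (u k l m) = loc_scale (- (2 * (lb l + of_nat m) - (kb k + of_nat m))) (u k l m)"
  by (simp_all add: loc_act_u_def Let_def matrix_entries kb_def[symmetric] lb_def[symmetric]
      algebra_simps)

lemma w_eq: "w k l m = (\<Sum>n\<le>m. loc_scale
    (of_nat (m choose n) * (pochhammer (lb l) n / pochhammer (kb k + lb l) n))
    (u (k + int n) (l + int n) (m - n)))"
  by (simp add: w_vec_def kb_def lb_def Let_def atLeast0AtMost)

lemma w_0 [simp]: "w k l 0 = u k l 0"
  by (simp add: w_eq)

lemma w_1: "w k l (Suc 0) = u k l 1 + loc_scale (lb l / (kb k + lb l)) (u (k + 1) (l + 1) 0)"
  by (simp add: w_eq)

lemma act_h_w:
  "act sl3_h1 (w k l m) = loc_scale (- (2 * (kb k + of_nat m) - (lb l + of_nat m))) (w k l m)"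
  "act sl3_h2 (w k l m) = loc_scale (- (2 * (lb l + of_nat m) - (kb k + of_nat m))) (w k l m)"
  unfolding w_eq loc_act.sum loc.scale_sum_right
  by (intro sum.cong refl; simp add: loc_act_scale act_u of_nat_diff mult.commute del: loc_act_u_vec)+

lemma act_f12_w: "act sl3_f12 (w k l m) = loc_scale (kb k + lb l + of_nat m) (w k l (Suc m))"
proof (rule poly_mapping_eqI)
  fix i
  define s where "s = kb k + lb l"
  define c where "c j n = of_nat (j choose n) * (pochhammer (lb l) n / pochhammer s n)" for j n
  define x where "x n = Poly_Mapping.lookup (u (k + int n) (l + int n) (Suc m - n)) i" for n
  have w_c: "w k l j = (\<Sum>n\<le>j. loc_scale (c j n) (u (k + int n) (l + int n) (j - n)))" for j
    by (simp add: w_eq c_def s_def)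
  \<comment> \<open>This compares the coefficients of \<open>x (Suc n)\<close> on both sides. After
    the common quotient of Pochhammer symbols is taken out, Pascal's rule reduces it to the identity
    \<open>b\<close>.\<close>
  have step: "c m (Suc n) * (s + of_nat m + of_nat (Suc n)) + c m n * (lb l + of_nat n) =
      (s + of_nat m) * c (Suc m) (Suc n)" if "n \<le> m" for n
  proof -
    have s: "s + of_nat n \<noteq> 0" "pochhammer s n \<noteq> 0"
      by (simp_all add: s_def)
    have "(of_nat (Suc n) * of_nat (m choose Suc n) :: complex) = of_nat ((m - n) * (m choose n))"
      by (metis binomial_absorb_comp binomial_absorption of_nat_mult)
    then have b: "(1 + of_nat n) * of_nat (m choose Suc n) =
        (of_nat m - of_nat n) * (of_nat (m choose n) :: complex)"
      using that by (simp add: of_nat_diff)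
    have "of_nat (m choose Suc n) * (s + of_nat m + of_nat (Suc n)) + of_nat (m choose n) * (s + of_nat n)
      = (s + of_nat m) * of_nat (Suc m choose Suc n)"
      using b by (simp add: algebra_simps)
    moreover have "c m (Suc n) * (s + of_nat m + of_nat (Suc n)) + c m n * (lb l + of_nat n) =
       (of_nat (m choose Suc n) * (s + of_nat m + of_nat (Suc n)) + of_nat (m choose n) * (s + of_nat n))
       * (pochhammer (lb l) (Suc n) / pochhammer s (Suc n))"
      using s by (simp add: c_def pochhammer_Suc divide_simps) (simp add: algebra_simps)
    ultimately show ?thesis
      by (simp add: c_def)
  qed
  have "Poly_Mapping.lookup (act sl3_f12 (w k l m)) i =
    (\<Sum>n\<le>m. c m n * (s + of_nat m + of_nat n) * x n) + (\<Sum>n\<le>m. c m n * (lb l + of_nat n) * x (Suc n))"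
    unfolding w_c loc_act.sum lookup_sum sum.distrib[symmetric]
    by (intro sum.cong refl)
      (simp add: loc_act_scale act_u lookup_add x_def s_def of_nat_diff Suc_diff_le
        algebra_simps del: loc_act_u_vec)
  also have "(\<Sum>n\<le>m. c m n * (s + of_nat m + of_nat n) * x n) =
    c m 0 * (s + of_nat m) * x 0 + (\<Sum>n\<le>m. c m (Suc n) * (s + of_nat m + of_nat (Suc n)) * x (Suc n))"
  proof -
    \<comment> \<open>The additional term for \<open>Suc m\<close> is zero because its binomial
      coefficient is; with it, the sum can be split at n = 0 and shifted.\<close>
    have "(\<Sum>n\<le>m. c m n * (s + of_nat m + of_nat n) * x n) =
      (\<Sum>n\<le>Suc m. c m n * (s + of_nat m + of_nat n) * x n)"
      by (simp add: c_def)
    then show ?thesis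
      by (simp only: sum.atMost_Suc_shift) simp
  qed
  also have "c m 0 * (s + of_nat m) * x 0
    + (\<Sum>n\<le>m. c m (Suc n) * (s + of_nat m + of_nat (Suc n)) * x (Suc n))
    + (\<Sum>n\<le>m. c m n * (lb l + of_nat n) * x (Suc n)) =
    (s + of_nat m) * c (Suc m) 0 * x 0 + (\<Sum>n\<le>m. (s + of_nat m) * c (Suc m) (Suc n) * x (Suc n))"
    by (simp add: sum.distrib[symmetric] distrib_right[symmetric] step c_def[of _ 0] flip: step)
  also have "\<dots> = (\<Sum>n\<le>Suc m. (s + of_nat m) * c (Suc m) n * x n)"
    by (simp only: sum.atMost_Suc_shift)
  also have "\<dots> = Poly_Mapping.lookup (loc_scale (kb k + lb l + of_nat m) (w k l (Suc m))) i"
    by (simp add: w_c lookup_sum sum_distrib_left x_def s_def mult.assoc del: sum.atMost_Suc)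
  finally show "Poly_Mapping.lookup (act sl3_f12 (w k l m)) i =
    Poly_Mapping.lookup (loc_scale (kb k + lb l + of_nat m) (w k l (Suc m))) i" .
qed

text \<open>Up to a nonzero scalar, \<open>w k l (Suc m)\<close> is the image of
  \<open>w k l m\<close> under \<open>sl3_f12\<close>. An induction on m can therefore be carried
  out after multiplying by that scalar, which \<open>scale_cancel\<close> removes.\<close>

lemma act_w_Suc:
  "loc_scale (kb k + lb l + of_nat m) (act X (w k l (Suc m))) = act X (act sl3_f12 (w k l m))"
  by (simp add: act_f12_w loc_act_scale)

lemma scale_cancel:
  "loc_scale (kb k + lb l + of_nat m) v = loc_scale (kb k + lb l + of_nat m) v' \<Longrightarrow> v = v'"
  by simp

lemmas w_linear_simps =
  loc_act_add loc_act_scale act_f12_w lookup_add lookup_minus lookup_loc_scale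

text \<open>The constant \<open>q\<close> comes entirely from m = 0, by rewriting
  \<open>u (k - 1) l 1\<close> through \<open>w_1\<close>. Since \<open>sl3_f2\<close> commutes with
  \<open>sl3_f12\<close>, it persists for all m.\<close>

lemma act_f2_w: "act sl3_f2 (w k l m) = loc_scale (kb k) (w (k - 1) l (Suc m))
    + loc_scale ((kb k + lb l + of_nat m) * q k l) (w k (l + 1) m)"
proof (induction m)
  case 0
  show ?case
    by (rule poly_mapping_eqI)
      (simp only: w_0 act_u w_1 w_linear_simps, simp add: q_def divide_simps, simp add: algebra_simps)
next
  case (Suc m)
  show ?case
    by (rule scale_cancel[of k l m], unfold act_w_Suc loc_act_commutators Suc, rule poly_mapping_eqI)
      (simp only: w_linear_simps, simp add: algebra_simps)
qed

lemma act_f1_w: "act sl3_f1 (w k l m) = loc_scale (- lb l) (w k (l - 1) (Suc m))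
    + loc_scale ((kb k + lb l + of_nat m) * p k l) (w (k + 1) l m)"
proof (induction m)
  case 0
  show ?case
    by (rule poly_mapping_eqI)
      (simp only: w_0 act_u w_1 w_linear_simps, simp add: p_def divide_simps, simp add: algebra_simps)
next
  case (Suc m)
  show ?case
    by (rule scale_cancel[of k l m], unfold act_w_Suc loc_act_commutators Suc, rule poly_mapping_eqI)
      (simp only: w_linear_simps, simp add: algebra_simps)
qed

text \<open>Passing \<open>sl3_e1\<close> across \<open>sl3_f12\<close> costs \<open>sl3_f2\<close>,
  so this rests on \<open>act_f2_w\<close>; likewise \<open>act_e2_w\<close> rests on
  \<open>act_f1_w\<close> and \<open>act_e12_w\<close> on \<open>act_h_w\<close>. The index
  \<open>m - 1\<close> is harmless at m = 0, where its coefficient vanishes.\<close>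

lemma act_e1_w: "act sl3_e1 (w k l m) = loc_scale (- kb k) (w (k - 1) l m)
    + loc_scale (- (of_nat m * q k l)) (w k (l + 1) (m - 1))"
proof (induction m)
  case 0
  show ?case
    by (simp add: act_u del: loc_act_u_vec)
next
  case (Suc m)
  show ?case
    by (rule scale_cancel[of k l m], unfold act_w_Suc loc_act_commutators Suc act_f2_w,
        rule poly_mapping_eqI, cases m)
      (simp_all only: w_linear_simps, simp_all add: algebra_simps)
qed

lemma act_e2_w: "act sl3_e2 (w k l m) = loc_scale (- lb l) (w k (l - 1) m)
    + loc_scale (of_nat m * p k l) (w (k + 1) l (m - 1))"
proof (induction m)
  case 0
  show ?case
    by (simp add: act_u del: loc_act_u_vec)
next
  case (Suc m)
  show ?case
    by (rule scale_cancel[of k l m], unfold act_w_Suc loc_act_commutators Suc act_f1_w,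
        rule poly_mapping_eqI, cases m)
      (simp_all only: w_linear_simps, simp_all add: algebra_simps)
qed

lemma act_e12_w: "act sl3_e12 (w k l m) = loc_scale (- of_nat m) (w k l (m - 1))"
proof (induction m)
  case 0
  show ?case
    by (simp add: act_u del: loc_act_u_vec)
next
  case (Suc m)
  show ?case
    by (rule scale_cancel[of k l m], unfold act_w_Suc loc_act_commutators Suc act_h_w,
        rule poly_mapping_eqI, cases m)
      (simp_all only: w_linear_simps, simp_all add: algebra_simps)
qed

section \<open>The vectors \<open>w\<close> as a basis\<close>

lemma lookup_w:
  "Poly_Mapping.lookup (w k l m) (k', l', m') \<noteq> 0 \<Longrightarrow> m' < m \<or> (k', l', m') = (k, l, m)"
proof -
  assume "Poly_Mapping.lookup (w k l m) (k', l', m') \<noteq> 0"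
  then obtain n where n: "n \<le> m"
    and "Poly_Mapping.lookup (u (k + int n) (l + int n) (m - n)) (k', l', m') \<noteq> 0"
    unfolding w_eq lookup_sum lookup_loc_scale by (metis (lifting) atMost_iff mult_zero_right sum.neutral)
  then have "k' = k + int n" "l' = l + int n" "m' = m - n"
    by (auto simp: u_vec_def lookup_single when_def split: if_splits)
  with n show ?thesis
    by (cases n) auto
qed

text \<open>Only the term n = 0 of \<open>w k l m\<close> keeps the third index m. With
  \<open>lookup_w\<close>, the passage from \<open>u\<close> to \<open>w\<close> is unitriangular
  for the order by m.\<close>

lemma lookup_w_same: "Poly_Mapping.lookup (w k l m) (k, l, m) = 1"
proof -
  have "Poly_Mapping.lookup (w k l m) (k, l, m) =
    (\<Sum>n\<le>m. if n = 0 then 1 else 0)"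
    unfolding w_eq lookup_sum
    by (intro sum.cong refl) (auto simp: u_vec_def lookup_single when_def)
  then show ?thesis
    by simp
qed

abbreviation "wi \<equiv> \<lambda>(k, l, m). w k l m"

lemma inj_w: "inj wi"
proof (rule injI)
  fix i j
  assume eq: "wi i = wi j"
  obtain k l m k' l' m' where ij: "i = (k, l, m)" "j = (k', l', m')"
    by (metis prod_cases3)
  then have "Poly_Mapping.lookup (w k' l' m') (k, l, m) = 1"
    "Poly_Mapping.lookup (w k l m) (k', l', m') = 1"
    using eq lookup_w_same[of k l m] lookup_w_same[of k' l' m'] by simp_all
  then show "i = j"
    using lookup_w[of k l m k' l' m'] lookup_w[of k' l' m' k l m] ij by auto
qed

lemma independent_w: "loc.independent (range wi)"
proof -
  have scalars_zero: "c i = 0"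
    if S: "finite S" and 0: "(\<Sum>i\<in>S. loc_scale (c i) (wi i)) = 0" and i: "i \<in> S" for S c i
  proof (rule ccontr)
    assume "c i \<noteq> 0"
    define T where "T = {i \<in> S. c i \<noteq> 0}"
    have "finite T"
      using S by (simp add: T_def)
    moreover have "i \<in> T"
      using i \<open>c i \<noteq> 0\<close> by (simp add: T_def)
    \<comment> \<open>An index j of largest m among those with nonzero scalar is chosen. By
      unitriangularity no other such vector has a component at j, so the coefficient of the sum at j
      is \<open>c j\<close>.\<close>
    ultimately have "Max ((\<lambda>i. snd (snd i)) ` T) \<in> (\<lambda>i. snd (snd i)) ` T"
      by (intro Max_in) auto
    then obtain j where "j \<in> T" "Max ((\<lambda>i. snd (snd i)) ` T) = snd (snd j)"
      by blast
    moreover have "snd (snd i) \<le> Max ((\<lambda>i. snd (snd i)) ` T)" if "i \<in> T" for i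
      using \<open>finite T\<close> that by (intro Max_ge) auto
    ultimately have j: "j \<in> T" "\<And>i. i \<in> T \<Longrightarrow> snd (snd i) \<le> snd (snd j)"
      by metis+
    have other: "c i * Poly_Mapping.lookup (wi i) j = 0" if "i \<in> S" "i \<noteq> j" for i
    proof (rule ccontr)
      assume "c i * Poly_Mapping.lookup (wi i) j \<noteq> 0"
      then have nz: "c i \<noteq> 0" "Poly_Mapping.lookup (wi i) j \<noteq> 0"
        by simp_all
      obtain k l m k' l' m' where ij: "i = (k, l, m)" "j = (k', l', m')"
        by (metis prod_cases3)
      have "m' < m"
        using lookup_w[of k l m k' l' m'] nz(2) \<open>i \<noteq> j\<close> unfolding ij prod.case by auto
      moreover have "i \<in> T"
        using nz(1) \<open>i \<in> S\<close> unfolding T_def by (intro CollectI conjI)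
      ultimately show False
        using j(2)[of i] unfolding ij by simp
    qed
    have "0 = (\<Sum>i\<in>S. c i * Poly_Mapping.lookup (wi i) j)"
      using arg_cong[OF 0, of "\<lambda>v. Poly_Mapping.lookup v j"] by (simp add: lookup_sum)
    also have "\<dots> = (\<Sum>i\<in>{j}. c i * Poly_Mapping.lookup (wi i) j)"
      using S j(1) other by (intro sum.mono_neutral_right) (auto simp: T_def)
    also have "\<dots> = c j"
      by (cases j) (simp add: lookup_w_same)
    finally show False
      using j(1) by (simp add: T_def)
  qed
  show ?thesis
    unfolding loc.independent_explicit_module
  proof (intro allI impI)
    fix T c v
    assume "finite T" "T \<subseteq> range wi" and 0: "(\<Sum>v\<in>T. loc_scale (c v) v) = 0" and v: "v \<in> T"
    then obtain S where S: "finite S" "T = wi ` S"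
      using finite_subset_image[of T wi UNIV] by auto
    have "inj_on wi S"
      using inj_w by (rule inj_on_subset) simp
    then have "(\<Sum>i\<in>S. loc_scale (c (wi i)) (wi i)) = 0"
      using 0 unfolding S(2) by (simp only: sum.reindex o_def)
    then have "c (wi i) = 0" if "i \<in> S" for i
      using scalars_zero[OF S(1), of "\<lambda>i. c (wi i)"] that by simp
    then show "c v = 0"
      using v unfolding S(2) by blast
  qed
qed

text \<open>This inverts the unitriangular relation: \<open>u k l m\<close> is
  \<open>w k l m\<close> minus terms of smaller third index.\<close>

lemma u_in_span_w: "u k l m \<in> loc.span (range wi)"
proof (induction m arbitrary: k l rule: less_induct)
  case (less m)
  define f where "f n = loc_scale
      (of_nat (m choose n) * (pochhammer (lb l) n / pochhammer (kb k + lb l) n))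
      (u (k + int n) (l + int n) (m - n))" for n
  have "w k l m = f 0 + sum f ({..m} - {0})"
    unfolding w_eq f_def[symmetric] by (rule sum.remove) simp_all
  moreover have "f 0 = u k l m"
    by (simp add: f_def)
  ultimately have w_split: "w k l m = u k l m + sum f ({..m} - {0})"
    by simp
  have "sum f ({..m} - {0}) \<in> loc.span (range wi)"
    unfolding f_def by (intro loc.span_sum loc.span_scale less) auto
  moreover have "w k l m \<in> loc.span (range wi)"
    using loc.span_base[OF rangeI[of wi "(k, l, m)"]] by simp
  ultimately show ?case
    unfolding w_split by (simp only: loc.span_add_eq2)
qed

lemma span_w: "loc.span (range wi) = UNIV"
proof -
  have "loc.span (range (\<lambda>(k, l, m). u k l m)) \<subseteq> loc.span (range wi)"
    by (rule loc.span_minimal) (auto simp: u_in_span_w loc.subspace_span simp del: loc.span_UNIV)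
  then show ?thesis
    by (simp add: span_u top_unique)
qed

lemma linear_eqI_w:
  assumes "Vector_Spaces.linear loc_scale (*) f" "Vector_Spaces.linear loc_scale (*) g"
    and "\<And>k l m. f (w k l m) = g (w k l m)"
  shows "f = g"
proof
  interpret vector_space_pair loc_scale "(*) :: complex \<Rightarrow> _"
    using assms(1) by (simp add: Vector_Spaces.linear_iff vector_space_pair_def)
  show "f v = g v" for v
    by (rule linear_eq_on[OF assms(1,2), of v "range wi"]) (auto simp: span_w assms(3))
qed

abbreviation "\<eta> \<equiv> eta \<mu>1 \<mu>2"

lemma linear_eta: "Vector_Spaces.linear loc_scale (*) (\<eta> k l m)"
proof -
  have "vector_space ((*) :: complex \<Rightarrow> complex \<Rightarrow> complex)"
    by unfold_locales (simp_all add: algebra_simps)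
  then show ?thesis
    unfolding Vector_Spaces.linear_iff eta_def
    by (simp add: vector_space_loc_scale loc.representation_add loc.representation_scale
        independent_w span_w)
qed

lemma eta_w: "\<eta> k l m (w k' l' m') = (if k' = k \<and> l' = l \<and> m' = m then 1 else 0)"
proof -
  have "loc.representation (range wi) (w k' l' m') = (\<lambda>v. if v = w k' l' m' then 1 else 0)"
    using loc.representation_basis[OF independent_w rangeI[of wi "(k', l', m')"]] by simp
  moreover have "w k l m = w k' l' m' \<longleftrightarrow> k' = k \<and> l' = l \<and> m' = m"
    using inj_eq[OF inj_w, of "(k, l, m)" "(k', l', m')"] by auto
  ultimately show ?thesis
    by (simp add: eta_def)
qed

section \<open>The dual module and its submodules\<close>

definition weight :: "int \<times> int \<times> nat \<Rightarrow> complex \<times> complex \<times> complex" where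
  "weight = (\<lambda>(k, l, m). (- (2 * (kb k + of_nat m) - (lb l + of_nat m)),
     - (2 * (lb l + of_nat m) - (kb k + of_nat m)),
     - (of_nat m * (kb k + lb l + of_nat m - 1))))"

text \<open>The first two eigenvalues determine a = \<open>kb k + of_nat m\<close> and b =
  \<open>lb l + of_nat m\<close>, the Cartan matrix having determinant 3. With c = a + b - 1 the
  third is - m (c - m), so m and m' can differ only if m + m' = c, which would make
  \<open>kb k + lb l\<close> an integer.\<close>

lemma inj_weight: "inj weight"
proof (rule injI)
  fix i j
  assume "weight i = weight j"
  moreover obtain k l m k' l' m' where ij: "i = (k, l, m)" "j = (k', l', m')"
    by (metis prod_cases3)
  ultimately have eq: "weight (k, l, m) = weight (k', l', m')"
    by simp
  define a b c :: complex where "a = kb k + of_nat m" and "b = lb l + of_nat m" and "c = a + b - 1"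
  define a' b' :: complex where "a' = kb k' + of_nat m'" and "b' = lb l' + of_nat m'"
  have eqs: "2 * a - b = 2 * a' - b'" "2 * b - a = 2 * b' - a'"
    "of_nat m * (kb k + lb l + of_nat m - 1) = (of_nat m' * (kb k' + lb l' + of_nat m' - 1) :: complex)"
    using eq unfolding weight_def prod.case prod.inject neg_equal_iff_equal a_def b_def a'_def b'_def
    by blast+
  have "3 * a = 2 * (2 * a - b) + (2 * b - a)" "3 * b = (2 * a - b) + 2 * (2 * b - a)"
    by simp_all
  then have "3 * a = 3 * a'" "3 * b = 3 * b'"
    unfolding eqs(1,2) by simp_all
  then have ab: "a = a'" "b = b'"
    by simp_all
  have c_kl: "c - of_nat m = kb k + lb l + of_nat m - 1"
    by (simp add: a_def b_def c_def)
  have c_kl': "c - of_nat m' = kb k' + lb l' + of_nat m' - 1"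
    unfolding c_def ab by (simp add: a'_def b'_def)
  have "of_nat m * (c - of_nat m) = of_nat m' * (c - of_nat m')"
    using eqs(3) unfolding c_kl c_kl' .
  then have "(of_nat m - of_nat m') * (c - of_nat m - of_nat m') = (0 :: complex)"
    by (simp add: algebra_simps)
  moreover have "c - of_nat m - of_nat m' \<noteq> 0"
    using sum_nonzero[of "of_nat m - of_nat m' - 1" k l] by (simp add: a_def b_def c_def algebra_simps)
  ultimately have "m = m'"
    by simp
  with ab show "i = j"
    by (simp add: ij a_def b_def a'_def b'_def kb_def lb_def)
qed

lemma w_in_eigenspace: "w k l m \<in> sl3_eigenspace loc_scale act (weight (k, l, m))"
  by (cases m)
    (simp_all only: weight_def prod.case sl3_eigenspace.simps mem_Collect_eq act_h_w act_e12_w loc_act_scale act_f12_w,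
     simp_all add: algebra_simps)

lemma linear_functional:
  assumes "Vector_Spaces.linear loc_scale (*) f"
  shows "f (v + v') = f v + f v'" "f (loc_scale c v) = c * f v" "f 0 = 0" "f (- v) = - f v"
    "f (v - v') = f v - f v'"
proof -
  interpret Vector_Spaces.linear loc_scale "(*)" f by fact
  show "f (v + v') = f v + f v'" "f (loc_scale c v) = c * f v" "f 0 = 0" "f (- v) = - f v"
    "f (v - v') = f v - f v'"
    by (simp_all add: add scale neg diff)
qed

lemma linear_functionalI:
  assumes "\<And>v v'. f (v + v') = f v + f v'" "\<And>c v. f (loc_scale c v) = c * f v"
  shows "Vector_Spaces.linear loc_scale (*) f"
  using linear_eta[of 0 0 0] assms unfolding Vector_Spaces.linear_iff by simp

lemma linear_functional_compose_act:
  assumes "Vector_Spaces.linear loc_scale (*) f"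
  shows "Vector_Spaces.linear loc_scale (*) (\<lambda>v. f (act X v))"
  by (rule linear_functionalI) (simp_all add: loc_act_add loc_act_scale linear_functional[OF assms])

abbreviation "dual \<equiv> loc_dual_act \<mu>1 \<mu>2"

lemma linear_dual_act:
  assumes "Vector_Spaces.linear loc_scale (*) f"
  shows "Vector_Spaces.linear loc_scale (*) (dual X f)"
  unfolding loc_dual_act_def dual_act_def
  by (rule linear_functionalI) (simp_all add: loc_act_add loc_act_scale linear_functional[OF assms])

lemma linear_functional_scale:
  assumes "Vector_Spaces.linear loc_scale (*) f"
  shows "Vector_Spaces.linear loc_scale (*) (functional_scale c f)"
  by (rule linear_functionalI)
    (simp_all add: functional_scale_def linear_functional[OF assms] distrib_left)

lemma linear_functional_add:
  assumes "Vector_Spaces.linear loc_scale (*) f" "Vector_Spaces.linear loc_scale (*) g"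
  shows "Vector_Spaces.linear loc_scale (*) (f + g)"
  by (rule linear_functionalI)
    (simp_all add: linear_functional[OF assms(1)] linear_functional[OF assms(2)] distrib_left)

text \<open>Composing \<open>\<eta> k l m\<close> with any of the three operators multiplies it by
  the corresponding eigenvalue of \<open>w k l m\<close>, as is seen on the basis \<open>w\<close>.
  On an eigenvector with a different eigenvalue triple this forces the value 0.\<close>

lemma eta_in_component: "\<eta> k l m \<in> sl3_dual_component loc_scale act (weight (k, l, m))"
proof -
  obtain a b c where abc: "weight (k, l, m) = (a, b, c)"
    by (metis prod_cases3)
  have w: "act sl3_h1 (w k l m) = loc_scale a (w k l m)" "act sl3_h2 (w k l m) = loc_scale b (w k l m)"
    "act sl3_f12 (act sl3_e12 (w k l m)) = loc_scale c (w k l m)"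
    using w_in_eigenspace[of k l m] by (simp_all add: abc)
  note lin = linear_functional[OF linear_eta]
  have scaled: "Vector_Spaces.linear loc_scale (*) (\<lambda>v. d * \<eta> k l m v)" for d
    by (rule linear_functionalI) (simp_all add: lin algebra_simps)
  have eig: "\<exists>d. A (w k' l' m') = loc_scale d (w k' l' m')"
    if "A \<in> {act sl3_h1, act sl3_h2, \<lambda>v. act sl3_f12 (act sl3_e12 v)}" for A k' l' m'
    using that w_in_eigenspace[of k' l' m'] by (cases "weight (k', l', m')") auto
  have comp: "(\<lambda>v. \<eta> k l m (A v)) = (\<lambda>v. d * \<eta> k l m v)"
    if A: "A \<in> {act sl3_h1, act sl3_h2, \<lambda>v. act sl3_f12 (act sl3_e12 v)}"
      and d: "A (w k l m) = loc_scale d (w k l m)" for A d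
  proof (rule linear_eqI_w)
    show "Vector_Spaces.linear loc_scale (*) (\<lambda>v. \<eta> k l m (A v))"
      using A linear_functional_compose_act linear_eta by blast
    show "\<eta> k l m (A (w k' l' m')) = d * \<eta> k l m (w k' l' m')" for k' l' m'
      using eig[OF A, of k' l' m'] d by (cases "(k', l', m') = (k, l, m)") (auto simp: lin eta_w)
  qed (rule scaled)
  have "\<eta> k l m v = 0" if \<theta>: "\<theta> \<noteq> weight (k, l, m)" and v: "v \<in> sl3_eigenspace loc_scale act \<theta>" for \<theta> v
  proof (rule ccontr)
    assume nz: "\<eta> k l m v \<noteq> 0"
    obtain a' b' c' where \<theta>': "\<theta> = (a', b', c')"
      by (metis prod_cases3)
    have "a' * \<eta> k l m v = a * \<eta> k l m v" "b' * \<eta> k l m v = b * \<eta> k l m v" "c' * \<eta> k l m v = c * \<eta> k l m v"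
      using v comp[of "act sl3_h1", OF _ w(1), THEN fun_cong, of v] comp[of "act sl3_h2", OF _ w(2), THEN fun_cong, of v]
        comp[of "\<lambda>v. act sl3_f12 (act sl3_e12 v)", OF _ w(3), THEN fun_cong, of v]
      by (simp_all add: \<theta>' lin)
    with nz \<theta> \<theta>' abc show False
      by simp
  qed
  then show ?thesis
    using linear_eta by (auto simp: sl3_dual_component_def)
qed

section \<open>The dual as the space of finitely supported functionals\<close>

abbreviation "support f \<equiv> {i. f (wi i) \<noteq> 0}"

lemma functional_eq_sum_eta:
  assumes f: "Vector_Spaces.linear loc_scale (*) f" and fin: "finite (support f)"
  shows "f = (\<Sum>(k, l, m)\<in>support f. functional_scale (f (w k l m)) (\<eta> k l m))"
proof (rule linear_eqI_w[OF f])
  have apply_sum: "(\<Sum>i\<in>S. g i) v = (\<Sum>i\<in>S. g i v)" for S v and g :: "_ \<Rightarrow> loc \<Rightarrow> complex"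
    by (induction S rule: infinite_finite_induct) auto
  show "Vector_Spaces.linear loc_scale (*)
     (\<Sum>(k, l, m)\<in>support f. functional_scale (f (w k l m)) (\<eta> k l m))"
    by (rule linear_functionalI)
      (simp_all add: apply_sum functional_scale_def case_prod_unfold linear_functional[OF linear_eta]
        sum.distrib sum_distrib_left algebra_simps)
  fix k l m
  have "(\<Sum>(k', l', m')\<in>support f. functional_scale (f (w k' l' m')) (\<eta> k' l' m')) (w k l m) =
    (\<Sum>i\<in>support f. if i = (k, l, m) then f (w k l m) else 0)"
    unfolding apply_sum by (intro sum.cong refl) (auto simp: functional_scale_def eta_w split: if_splits)
  then show "f (w k l m) =
    (\<Sum>(k, l, m)\<in>support f. functional_scale (f (w k l m)) (\<eta> k l m)) (w k l m)"
    using fin by simp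
qed

lemma eta_in_dual: "\<eta> k l m \<in> loc_dual \<mu>1 \<mu>2"
  unfolding loc_dual_def sl3_dual_def using eta_in_component by (blast intro: functional.span_base)

lemma subspace_loc_dual: "functional.subspace (loc_dual \<mu>1 \<mu>2)"
  unfolding loc_dual_def sl3_dual_def by (rule functional.subspace_span)

lemma subspace_finite_support:
  "functional.subspace {f. Vector_Spaces.linear loc_scale (*) f \<and> finite (support f)}"
proof (rule functional.subspaceI; unfold mem_Collect_eq; (elim conjE)?; intro conjI)
  show "Vector_Spaces.linear loc_scale (*) (0 :: loc \<Rightarrow> complex)"
    by (rule linear_functionalI) simp_all
  show "finite (support 0)"
    by simp
next
  fix f g :: "loc \<Rightarrow> complex"
  assume f: "Vector_Spaces.linear loc_scale (*) f" "finite (support f)"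
    and g: "Vector_Spaces.linear loc_scale (*) g" "finite (support g)"
  show "Vector_Spaces.linear loc_scale (*) (f + g)"
    using f(1) g(1) by (rule linear_functional_add)
  have "support (f + g) \<subseteq> support f \<union> support g"
    by auto
  then show "finite (support (f + g))"
    by (rule finite_subset) (simp add: f g)
next
  fix c and f :: "loc \<Rightarrow> complex"
  assume f: "Vector_Spaces.linear loc_scale (*) f" "finite (support f)"
  show "Vector_Spaces.linear loc_scale (*) (functional_scale c f)"
    using f(1) by (rule linear_functional_scale)
  have "support (functional_scale c f) \<subseteq> support f"
    by (auto simp: functional_scale_def)
  then show "finite (support (functional_scale c f))"
    using f(2) by (rule finite_subset)
qed

text \<open>By \<open>inj_weight\<close> at most one \<open>w\<close> lies in the eigenspace of
  \<open>\<theta>\<close>, and \<open>f\<close> vanishes on all the others.\<close>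

lemma finite_support_component:
  assumes "f \<in> sl3_dual_component loc_scale act \<theta>"
  shows "finite (support f)"
proof (rule finite_subset)
  have "f v = 0" if "\<theta>' \<noteq> \<theta>" "v \<in> sl3_eigenspace loc_scale act \<theta>'" for \<theta>' v
    using assms that unfolding sl3_dual_component_def by blast
  then show "support f \<subseteq> weight -` {\<theta>}"
    using w_in_eigenspace by fast
  show "finite (weight -` {\<theta>})"
    by (intro finite_vimageI inj_weight) simp
qed

text \<open>Components have finite support, and a functional of finite support is a finite
  combination of the \<open>\<eta>\<close>. Membership in the dual can thus be tested on the basis
  \<open>w\<close>.\<close>

lemma loc_dual_eq: "loc_dual \<mu>1 \<mu>2 = {f. Vector_Spaces.linear loc_scale (*) f \<and> finite (support f)}"
proof (intro equalityI subsetI)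
  have "(\<Union>\<theta>. sl3_dual_component loc_scale act \<theta>)
      \<subseteq> {f. Vector_Spaces.linear loc_scale (*) f \<and> finite (support f)}"
    using finite_support_component unfolding sl3_dual_component_def by blast
  then have "loc_dual \<mu>1 \<mu>2 \<subseteq> {f. Vector_Spaces.linear loc_scale (*) f \<and> finite (support f)}"
    unfolding loc_dual_def sl3_dual_def by (rule functional.span_minimal[OF _ subspace_finite_support])
  then show "f \<in> loc_dual \<mu>1 \<mu>2 \<Longrightarrow>
      f \<in> {f. Vector_Spaces.linear loc_scale (*) f \<and> finite (support f)}" for f
    by blast
next
  fix f
  assume "f \<in> {f. Vector_Spaces.linear loc_scale (*) f \<and> finite (support f)}"
  then have f: "f = (\<Sum>(k, l, m)\<in>support f. functional_scale (f (w k l m)) (\<eta> k l m))"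
    using functional_eq_sum_eta by blast
  show "f \<in> loc_dual \<mu>1 \<mu>2"
    by (subst f, unfold case_prod_unfold)
      (intro functional.subspace_sum functional.subspace_scale subspace_loc_dual eta_in_dual)
qed

text \<open>A bound on the three indices is easy to carry through index shifts: it only has to grow
  from N to N + 1 under a generator.\<close>

lemma finite_support_iff:
  "finite (support f) \<longleftrightarrow>
    (\<exists>N. \<forall>k l m. N < \<bar>k\<bar> \<or> N < \<bar>l\<bar> \<or> N < int m \<longrightarrow> f (w k l m) = 0)"
proof
  assume fin: "finite (support f)"
  define h where "h = (\<lambda>(k::int, l::int, m::nat). max \<bar>k\<bar> (max \<bar>l\<bar> (int m)))"
  obtain N where "\<forall>i\<in>support f. h i \<le> N"
    using fin by (metis bdd_above_finite bdd_above.unfold finite_imageI imageI)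
  then have "\<forall>k l m. N < \<bar>k\<bar> \<or> N < \<bar>l\<bar> \<or> N < int m \<longrightarrow> f (w k l m) = 0"
    by (force simp: h_def)
  then show "\<exists>N. \<forall>k l m. N < \<bar>k\<bar> \<or> N < \<bar>l\<bar> \<or> N < int m \<longrightarrow> f (w k l m) = 0" ..
next
  assume "\<exists>N. \<forall>k l m. N < \<bar>k\<bar> \<or> N < \<bar>l\<bar> \<or> N < int m \<longrightarrow> f (w k l m) = 0"
  then obtain N where N: "\<And>k l m. N < \<bar>k\<bar> \<or> N < \<bar>l\<bar> \<or> N < int m \<Longrightarrow> f (w k l m) = 0"
    by blast
  have "support f \<subseteq> {-N..N} \<times> {-N..N} \<times> {..nat N}"
  proof
    fix i
    assume i: "i \<in> support f"
    obtain k l m where klm: "i = (k, l, m)"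
      by (metis prod_cases3)
    have "\<not> (N < \<bar>k\<bar> \<or> N < \<bar>l\<bar> \<or> N < int m)"
      using i N[of k l m] unfolding klm mem_Collect_eq prod.case by blast
    then show "i \<in> {-N..N} \<times> {-N..N} \<times> {..nat N}"
      unfolding klm by auto
  qed
  then show "finite (support f)"
    by (rule finite_subset) auto
qed

lemma dual_act_closed:
  assumes X: "X \<in> sl3" and f: "f \<in> loc_dual \<mu>1 \<mu>2"
  shows "dual X f \<in> loc_dual \<mu>1 \<mu>2"
proof -
  have lin: "Vector_Spaces.linear loc_scale (*) f" and "finite (support f)"
    using f by (auto simp: loc_dual_eq)
  then obtain N where N: "\<And>k l m. N < \<bar>k\<bar> \<or> N < \<bar>l\<bar> \<or> N < int m \<Longrightarrow> f (w k l m) = 0"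
    by (auto simp: finite_support_iff)
  have zero: "f (act Y (w k l m)) = 0" if Y: "Y \<in> sl3" and out: "N + 1 < \<bar>k\<bar> \<or> N + 1 < \<bar>l\<bar> \<or> N + 1 < int m"
    for Y k l m
  proof -
    \<comment> \<open>These are all the vectors that the eight generators can produce from
      \<open>w k l m\<close>. Each index moves by at most one, so all of them remain beyond the
      bound N.\<close>
    have "f (w k l m) = 0" "f (w (k - 1) l m) = 0" "f (w k (l - 1) m) = 0" "f (w (k + 1) l m) = 0"
      "f (w k (l + 1) m) = 0" "f (w k l (m - 1)) = 0" "f (w k l (Suc m)) = 0" "f (w k (l - 1) (Suc m)) = 0"
      "f (w (k - 1) l (Suc m)) = 0" "f (w (k + 1) l (m - 1)) = 0" "f (w k (l + 1) (m - 1)) = 0"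
      by (rule N, use out in linarith)+
    then show ?thesis
      unfolding loc_act_generators_decomposition[OF Y] act_h_w act_e1_w act_e2_w act_f1_w act_f2_w
        act_e12_w act_f12_w linear_functional[OF lin]
      by simp
  qed
  have "dual X f (w k l m) = 0"
    if "N + 1 < \<bar>k\<bar> \<or> N + 1 < \<bar>l\<bar> \<or> N + 1 < int m" for k l m
    using zero[OF _ that, of "tau X"] X by (simp add: loc_dual_act_def dual_act_def tau_automorphism)
  then have "finite (support (dual X f))"
    unfolding finite_support_iff by blast
  moreover have "Vector_Spaces.linear loc_scale (*) (dual X f)"
    using lin by (rule linear_dual_act)
  ultimately show ?thesis
    by (simp add: loc_dual_eq)
qed

text \<open>Transposition reverses the order of two operators; the sign in \<open>dual_act\<close>
  compensates for this in the bracket, which \<open>tau\<close> preserves.\<close>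

lemma sl3_module_loc_dual: "sl3_module functional_scale (loc_dual \<mu>1 \<mu>2) (dual)"
proof
  show "functional.subspace (loc_dual \<mu>1 \<mu>2)"
    by (rule subspace_loc_dual)
  fix X Y f g c
  assume X: "X \<in> sl3" and f: "f \<in> loc_dual \<mu>1 \<mu>2"
  show "dual X f \<in> loc_dual \<mu>1 \<mu>2"
    using X f by (rule dual_act_closed)
  have lin: "Vector_Spaces.linear loc_scale (*) f"
    using f by (simp add: loc_dual_eq)
  note simps = fun_eq_iff loc_dual_act_def dual_act_def functional_scale_def tau_automorphism
    loc_act_add_left loc_act_scale_left loc_act_bracket linear_functional[OF lin]
  show "dual X (f + g) = dual X f + dual X g"
    by (simp add: simps)
  show "dual X (functional_scale c f) = functional_scale c (dual X f)"
    by (simp add: simps)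
  show "dual (X + Y) f = dual X f + dual Y f"
    by (simp add: simps)
  show "dual (matrix_scale c X) f = functional_scale c (dual X f)"
    by (simp add: simps)
  show "dual (bracket X Y) f =
     dual X (dual Y f) - dual Y (dual X f)"
    by (simp add: simps)
qed

section \<open>Transposed formulas on the functionals \<open>\<eta>\<close>\<close>

lemma dual_act_f12_eta: "dual sl3_f12 (\<eta> k l m) = functional_scale (- of_nat (Suc m)) (\<eta> k l (Suc m))"
proof (rule linear_eqI_w)
  have tau: "tau sl3_f12 = - sl3_e12"
    by (simp add: tau_def matrix_entries vec_eq_iff forall_3 vector_3)
  show "dual sl3_f12 (\<eta> k l m) (w k' l' m') =
      functional_scale (- of_nat (Suc m)) (\<eta> k l (Suc m)) (w k' l' m')" for k' l' m'
    by (cases m') (simp_all add: loc_dual_act_def dual_act_def tau loc_act_uminus_left act_e12_w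
        linear_functional[OF linear_eta] eta_w functional_scale_def del: w_0)
qed (intro linear_dual_act linear_functional_scale linear_eta)+

text \<open>Here \<open>tau\<close> turns \<open>sl3_e1\<close> into \<open>sl3_f1\<close>. The
  first summand of \<open>act_f1_w\<close> has positive third index and is killed by
  \<open>\<eta> k l 0\<close>, so a single functional remains; \<open>dual_act_e2_eta\<close> is
  analogous.\<close>

lemma dual_act_e1_eta: "dual sl3_e1 (\<eta> k l 0) =
    functional_scale (- ((kb k + lb l - 1) * p (k - 1) l)) (\<eta> (k - 1) l 0)"
proof (rule linear_eqI_w)
  show "dual sl3_e1 (\<eta> k l 0) (w k' l' m') =
      functional_scale (- ((kb k + lb l - 1) * p (k - 1) l)) (\<eta> (k - 1) l 0) (w k' l' m')" for k' l' m'
    by (auto simp: loc_dual_act_def dual_act_def tau_generators act_f1_w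
        linear_functional[OF linear_eta] eta_w functional_scale_def simp del: w_0)
qed (intro linear_dual_act linear_functional_scale linear_eta)+

lemma dual_act_e2_eta: "dual sl3_e2 (\<eta> k l 0) =
    functional_scale (- ((kb k + lb l - 1) * q k (l - 1))) (\<eta> k (l - 1) 0)"
proof (rule linear_eqI_w)
  show "dual sl3_e2 (\<eta> k l 0) (w k' l' m') =
      functional_scale (- ((kb k + lb l - 1) * q k (l - 1))) (\<eta> k (l - 1) 0) (w k' l' m')" for k' l' m'
    by (auto simp: loc_dual_act_def dual_act_def tau_generators act_f2_w
        linear_functional[OF linear_eta] eta_w functional_scale_def simp del: w_0)
qed (intro linear_dual_act linear_functional_scale linear_eta)+

lemma dual_act_f1_eta: "dual sl3_f1 (\<eta> k l 0) =
    functional_scale (kb k + 1) (\<eta> (k + 1) l 0) + functional_scale (q k (l - 1)) (\<eta> k (l - 1) (Suc 0))"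
proof (rule linear_eqI_w)
  show "dual sl3_f1 (\<eta> k l 0) (w k' l' m') =
    (functional_scale (kb k + 1) (\<eta> (k + 1) l 0)
     + functional_scale (q k (l - 1)) (\<eta> k (l - 1) (Suc 0))) (w k' l' m')" for k' l' m'
    by (cases m') (auto simp: loc_dual_act_def dual_act_def tau_generators act_e1_w
        linear_functional[OF linear_eta] eta_w functional_scale_def simp del: w_0)
qed (intro linear_dual_act linear_functional_scale linear_functional_add linear_eta)+

lemma dual_act_f2_eta: "dual sl3_f2 (\<eta> k l 0) =
    functional_scale (lb l + 1) (\<eta> k (l + 1) 0) + functional_scale (- p (k - 1) l) (\<eta> (k - 1) l (Suc 0))"
proof (rule linear_eqI_w)
  show "dual sl3_f2 (\<eta> k l 0) (w k' l' m') =
    (functional_scale (lb l + 1) (\<eta> k (l + 1) 0)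
     + functional_scale (- p (k - 1) l) (\<eta> (k - 1) l (Suc 0))) (w k' l' m')" for k' l' m'
    by (cases m') (auto simp: loc_dual_act_def dual_act_def tau_generators act_e2_w
        linear_functional[OF linear_eta] eta_w functional_scale_def simp del: w_0)
qed (intro linear_dual_act linear_functional_scale linear_functional_add linear_eta)+

lemma dual_act_scale: "dual X (functional_scale c f) = functional_scale c (dual X f)"
  by (simp add: loc_dual_act_def dual_act_def functional_scale_def)

text \<open>The role of \<open>x\<close> is played by \<open>kb k0\<close> or \<open>lb l0\<close>.
  A step is obstructed only at particular integer values of \<open>kb\<close> or \<open>lb\<close>,
  and these can occur only at the matching distance from the starting index.\<close>

lemma integer_offset:
  fixes x :: complex and j n :: int
  assumes "x = 0 \<or> x \<notin> \<int>" "x + of_int j = of_int n"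
  shows "j = n"
proof -
  have x: "x = of_int (n - j)"
    using assms(2) by (simp add: eq_diff_eq)
  then have "of_int (n - j) = (0 :: complex)"
    using assms(1) Ints_of_int[of "n - j"] by metis
  then show ?thesis
    by (simp only: of_int_eq_0_iff)
qed

lemma kb_eq_of_int:
  assumes "kb k0 = 0 \<or> kb k0 \<notin> \<int>" "kb k = of_int n"
  shows "k - k0 = n"
  by (rule integer_offset[OF assms(1)]) (use assms(2) in \<open>simp add: kb_def\<close>)

lemma lb_eq_of_int:
  assumes "lb l0 = 0 \<or> lb l0 \<notin> \<int>" "lb l = of_int n"
  shows "l - l0 = n"
  by (rule integer_offset[OF assms(1)]) (use assms(2) in \<open>simp add: lb_def\<close>)

section \<open>Moving between the \<open>\<eta>\<close> inside a submodule\<close>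

context
  fixes N
  assumes N: "sl3_submodule functional_scale (loc_dual \<mu>1 \<mu>2) dual N"
begin

lemma
  shows subspace_N: "functional.subspace N"
    and act_N: "X \<in> sl3 \<Longrightarrow> f \<in> N \<Longrightarrow> dual X f \<in> N"
  using N by (auto simp: sl3_submodule_def)

lemma unscale_N:
  assumes "functional_scale c f \<in> N" "c \<noteq> 0"
  shows "f \<in> N"
  using functional.subspace_scale[OF subspace_N assms(1), of "inverse c"] assms(2)
  by (simp add: functional.scale_scale)

lemma eta_raise:
  assumes "\<eta> k l 0 \<in> N"
  shows "\<eta> k l m \<in> N"
proof (induction m)
  case 0
  show ?case by fact
next
  case (Suc m)
  have "dual sl3_f12 (\<eta> k l m) \<in> N"
    by (intro act_N generators_in_sl3 Suc)
  then show ?case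
    unfolding dual_act_f12_eta by (rule unscale_N) (metis neg_equal_0_iff_equal of_nat_neq_0)
qed

text \<open>The numerator of \<open>p (k - 1) l\<close> is \<open>(kb k - 1) * (kb k - 2)\<close>,
  whose zeros are the two excluded values.\<close>

lemma eta_k_minus:
  assumes "\<eta> k l 0 \<in> N" "kb k \<noteq> 1" "kb k \<noteq> 2"
  shows "\<eta> (k - 1) l 0 \<in> N"
proof -
  have "dual sl3_e1 (\<eta> k l 0) \<in> N"
    by (intro act_N generators_in_sl3 assms)
  moreover have "- ((kb k + lb l - 1) * p (k - 1) l) \<noteq> 0"
    using assms(2,3) sum_nonzero_simps(1,2)[of "k - 1" l] by (simp add: p_def)
  ultimately show ?thesis
    unfolding dual_act_e1_eta by (rule unscale_N)
qed

lemma eta_l_minus: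
  assumes "\<eta> k l 0 \<in> N" "lb l \<noteq> 1" "lb l \<noteq> 2"
  shows "\<eta> k (l - 1) 0 \<in> N"
proof -
  have "dual sl3_e2 (\<eta> k l 0) \<in> N"
    by (intro act_N generators_in_sl3 assms)
  moreover have "- ((kb k + lb l - 1) * q k (l - 1)) \<noteq> 0"
    using assms(2,3) sum_nonzero_simps(1,2)[of k "l - 1"] by (simp add: q_def)
  ultimately show ?thesis
    unfolding dual_act_e2_eta by (rule unscale_N)
qed

lemma eta_k_plus:
  assumes "\<eta> k l 0 \<in> N" "kb k \<noteq> - 1"
  shows "\<eta> (k + 1) l 0 \<in> N"
proof -
  \<comment> \<open>Applying \<open>sl3_e2\<close> and then \<open>sl3_f12\<close> gives
    \<open>(kb k + lb l - 1) * q k (l - 1)\<close> times \<open>\<eta> k (l - 1) (Suc 0)\<close>, so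
    this factor cancels the unwanted term of \<open>dual_act_f1_eta\<close> without dividing by
    \<open>q\<close>, which may vanish.\<close>
  let ?c = "- inverse (kb k + lb l - 1)"
  have "functional_scale (kb k + 1) (\<eta> (k + 1) l 0) =
      dual sl3_f1 (\<eta> k l 0) + functional_scale ?c (dual sl3_f12 (dual sl3_e2 (\<eta> k l 0)))"
    unfolding dual_act_f1_eta dual_act_e2_eta dual_act_scale dual_act_f12_eta
    by (simp add: fun_eq_iff functional_scale_def)
  also have "\<dots> \<in> N"
    by (intro functional.subspace_add functional.subspace_scale subspace_N act_N generators_in_sl3 assms)
  finally show ?thesis
    by (rule unscale_N) (use assms(2) in \<open>simp add: eq_neg_iff_add_eq_0\<close>)
qed

lemma eta_l_plus:
  assumes "\<eta> k l 0 \<in> N" "lb l \<noteq> - 1"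
  shows "\<eta> k (l + 1) 0 \<in> N"
proof -
  \<comment> \<open>The sign is opposite to the one in \<open>eta_k_plus\<close> because
    \<open>p\<close> enters \<open>dual_act_f2_eta\<close> with a minus sign.\<close>
  let ?c = "inverse (kb k + lb l - 1)"
  have "functional_scale (lb l + 1) (\<eta> k (l + 1) 0) =
      dual sl3_f2 (\<eta> k l 0) + functional_scale ?c (dual sl3_f12 (dual sl3_e1 (\<eta> k l 0)))"
    unfolding dual_act_f2_eta dual_act_e1_eta dual_act_scale dual_act_f12_eta
    by (simp add: fun_eq_iff functional_scale_def)
  also have "\<dots> \<in> N"
    by (intro functional.subspace_add functional.subspace_scale subspace_N act_N generators_in_sl3 assms)
  finally show ?thesis
    by (rule unscale_N) (use assms(2) in \<open>simp add: eq_neg_iff_add_eq_0\<close>)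
qed

text \<open>The obstruction to going up would sit at \<open>k0 - 1\<close>, those to going down at
  \<open>k0 + 1\<close> and \<open>k0 + 2\<close>. Walking away from \<open>k0\<close> never meets
  them.\<close>

lemma eta_k_all:
  assumes "\<eta> k0 l 0 \<in> N" "kb k0 = 0 \<or> kb k0 \<notin> \<int>"
  shows "\<eta> k l 0 \<in> N"
proof (cases "k0 \<le> k")
  case True
  then show ?thesis
  proof (induction k rule: int_ge_induct)
    case (step k)
    have "kb k \<noteq> - 1"
      using kb_eq_of_int[OF assms(2), of k "- 1"] step.hyps by auto
    with step.IH show ?case
      by (rule eta_k_plus)
  qed (rule assms(1))
next
  case False
  then have "k \<le> k0"
    by simp
  then show ?thesis
  proof (induction k rule: int_le_induct)
    case (step k)
    have "kb k \<noteq> 1" "kb k \<noteq> 2"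
      using kb_eq_of_int[OF assms(2), of k 1] kb_eq_of_int[OF assms(2), of k 2] step.hyps by auto
    with step.IH show ?case
      by (rule eta_k_minus)
  qed (rule assms(1))
qed

lemma eta_l_all:
  assumes "\<eta> k l0 0 \<in> N" "lb l0 = 0 \<or> lb l0 \<notin> \<int>"
  shows "\<eta> k l 0 \<in> N"
proof (cases "l0 \<le> l")
  case True
  then show ?thesis
  proof (induction l rule: int_ge_induct)
    case (step l)
    have "lb l \<noteq> - 1"
      using lb_eq_of_int[OF assms(2), of l "- 1"] step.hyps by auto
    with step.IH show ?case
      by (rule eta_l_plus)
  qed (rule assms(1))
next
  case False
  then have "l \<le> l0"
    by simp
  then show ?thesis
  proof (induction l rule: int_le_induct)
    case (step l)
    have "lb l \<noteq> 1" "lb l \<noteq> 2"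
      using lb_eq_of_int[OF assms(2), of l 1] lb_eq_of_int[OF assms(2), of l 2] step.hyps by auto
    with step.IH show ?case
      by (rule eta_l_minus)
  qed (rule assms(1))
qed

end

text \<open>All three parts of the theorem are instances. From \<open>\<eta> k0 l0 0\<close> first
  k, then l, then m is made arbitrary, and the \<open>\<eta>\<close> span the dual.\<close>

lemma eta_generates:
  assumes k0: "kb k0 = 0 \<or> kb k0 \<notin> \<int>" and l0: "lb l0 = 0 \<or> lb l0 \<notin> \<int>"
  shows "generates_sl3_module functional_scale (loc_dual \<mu>1 \<mu>2) dual (\<eta> k0 l0 0)"
proof -
  have "loc_dual \<mu>1 \<mu>2 \<subseteq> N"
    if N: "sl3_submodule functional_scale (loc_dual \<mu>1 \<mu>2) dual N" and start: "\<eta> k0 l0 0 \<in> N" for N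
  proof
    have eta: "\<eta> k l m \<in> N" for k l m
      by (rule eta_raise[OF N eta_l_all[OF N eta_k_all[OF N start k0] l0]])
    fix f
    assume "f \<in> loc_dual \<mu>1 \<mu>2"
    then have f: "f = (\<Sum>(k, l, m)\<in>support f. functional_scale (f (w k l m)) (\<eta> k l m))"
      unfolding loc_dual_eq using functional_eq_sum_eta by blast
    show "f \<in> N"
      by (subst f, unfold case_prod_unfold)
        (intro functional.subspace_sum functional.subspace_scale subspace_N[OF N] eta)
  qed
  moreover have "sl3_submodule functional_scale (loc_dual \<mu>1 \<mu>2) dual (loc_dual \<mu>1 \<mu>2)"
    using subspace_loc_dual dual_act_closed by (simp add: sl3_submodule_def)
  ultimately have "\<Inter>{N. sl3_submodule functional_scale (loc_dual \<mu>1 \<mu>2) dual N \<and> \<eta> k0 l0 0 \<in> N} =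
      loc_dual \<mu>1 \<mu>2"
    using eta_in_dual by blast
  then show ?thesis
    unfolding generates_sl3_module_def using sl3_module_loc_dual eta_in_dual by blast
qed

end

theorem theorem7p1:
  fixes \<mu>1 \<mu>2 :: complex
  assumes "\<mu>1 + \<mu>2 \<notin> \<int>"
  shows "(\<forall>l k0 :: int. \<mu>2 = of_int l \<longrightarrow>
            generates_sl3_module functional_scale (loc_dual \<mu>1 \<mu>2) (loc_dual_act \<mu>1 \<mu>2)
              (eta \<mu>1 \<mu>2 k0 l 0)) \<and>
         (\<forall>k l0 :: int. \<mu>1 = of_int k \<longrightarrow>
            generates_sl3_module functional_scale (loc_dual \<mu>1 \<mu>2) (loc_dual_act \<mu>1 \<mu>2)
              (eta \<mu>1 \<mu>2 k l0 0)) \<and>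
         cyclic_sl3_module functional_scale (loc_dual \<mu>1 \<mu>2) (loc_dual_act \<mu>1 \<mu>2)"
proof -
  interpret nonintegral_sum \<mu>1 \<mu>2
    using assms by unfold_locales
  have kb_Ints: "kb k \<in> \<int> \<longleftrightarrow> \<mu>1 \<in> \<int>" for k
    unfolding kb_def by (metis Ints_diff Ints_of_int diff_diff_eq2 add_diff_cancel_left')
  have lb_Ints: "lb l \<in> \<int> \<longleftrightarrow> \<mu>2 \<in> \<int>" for l
    unfolding lb_def by (metis Ints_diff Ints_of_int diff_diff_eq2 add_diff_cancel_left')
  \<comment> \<open>If one parameter is an integer the other is not, so the index attached to the
    other parameter may start anywhere.\<close>
  have not_both: "\<mu>1 \<notin> \<int> \<or> \<mu>2 \<notin> \<int>"
    using assms Ints_add by blast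
  have a: "generates_sl3_module functional_scale (loc_dual \<mu>1 \<mu>2) (loc_dual_act \<mu>1 \<mu>2) (eta \<mu>1 \<mu>2 k0 l 0)"
    if "\<mu>2 = of_int l" for k0 l
  proof (rule eta_generates)
    show "kb k0 = 0 \<or> kb k0 \<notin> \<int>"
      using not_both that by (simp add: kb_Ints)
    show "lb l = 0 \<or> lb l \<notin> \<int>"
      unfolding lb_def using that by simp
  qed
  have b: "generates_sl3_module functional_scale (loc_dual \<mu>1 \<mu>2) (loc_dual_act \<mu>1 \<mu>2) (eta \<mu>1 \<mu>2 k l0 0)"
    if "\<mu>1 = of_int k" for k l0
  proof (rule eta_generates)
    show "kb k = 0 \<or> kb k \<notin> \<int>"
      unfolding kb_def using that by simp
    show "lb l0 = 0 \<or> lb l0 \<notin> \<int>"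
      using not_both that by (simp add: lb_Ints)
  qed
  \<comment> \<open>This is the case left over for cyclicity: with neither parameter an integer, any
    starting indices serve, and 0 is chosen.\<close>
  have c: "generates_sl3_module functional_scale (loc_dual \<mu>1 \<mu>2) (loc_dual_act \<mu>1 \<mu>2) (eta \<mu>1 \<mu>2 0 0 0)"
    if "\<mu>1 \<notin> \<int>" "\<mu>2 \<notin> \<int>"
    using that by (intro eta_generates) (simp_all add: kb_Ints lb_Ints)
  have "\<exists>k l. generates_sl3_module functional_scale (loc_dual \<mu>1 \<mu>2) (loc_dual_act \<mu>1 \<mu>2)
      (eta \<mu>1 \<mu>2 k l 0)"
    using a b c by (metis Ints_cases)
  then have "cyclic_sl3_module functional_scale (loc_dual \<mu>1 \<mu>2) (loc_dual_act \<mu>1 \<mu>2)"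
    unfolding cyclic_sl3_module_def using sl3_module_loc_dual eta_in_dual by blast
  with a b show ?thesis
    by blast
qed

end
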